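(* Let $t$ be a positive integer and let $G$ be a finite graph. If $G$ admits a Kneser-representation $\mathcal{H}$ with $\mathrm{cd}(\mathcal{H})\ge t$, then $G$ contains $K_t$ as a minor.
   Context: A hypergraph $\mathcal{H}=(V,E)$ consists of a finite vertex set $V$ and a set $E$ of subsets of $V$ (hyperedges). The Kneser graph $\mathrm{KG}(\mathcal{H})$ is the graph with vertex set $E$ in which two hyperedges $e_1,e_2$ are adjacent iff $e_1\cap e_2=\emptyset$. A hypergraph $\mathcal{H}$ is a Kneser-representation of a graph $G$ if $\mathrm{KG}(\mathcal{H})$ is isomorphic to $G$. A hypergraph is $2$-colorable if its vertices can be assigned one of two colors so that no hyperedge is entirely contained in one color class. The $2$-colorability defect of $\mathcal{H}=(V,E)$ is $\mathrm{cd}(\mathcal{H}):=\min\{|U| : U\subseteq V \text{ such that } (V\setminus U,\{e\in E: e\cap U=\emptyset\}) \text{ is 2-colorable}\}$. A graph $G$ contains $H$ as a minor if a graph isomorphic to $H$ can be obtained from $G$ by a sequence of vertex deletions, edge deletions and edge contractions. *)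

theory Defs
  imports "Graph_Theory.Graph_Theory"
begin

text \<open>Finite simple graphs are the finite, symmetric, loop-free digraphs of locale
  \<^locale>\<open>pair_graph\<close>: an undirected edge is a pair of opposite arcs.\<close>

definition hypergraph :: "'v set \<Rightarrow> 'v set set \<Rightarrow> bool" where
  "hypergraph V E \<longleftrightarrow> finite V \<and> (\<forall>e\<in>E. e \<subseteq> V)"

text \<open>Adjacency is plain disjointness, so an empty hyperedge carries a loop.\<close>

definition kneser_graph :: "'v set set \<Rightarrow> 'v set pair_pre_digraph" where
  "kneser_graph E = \<lparr>pverts = E, parcs = {(e\<^sub>1, e\<^sub>2). e\<^sub>1 \<in> E \<and> e\<^sub>2 \<in> E \<and> e\<^sub>1 \<inter> e\<^sub>2 = {}}\<rparr>"

definition kneser_representation ::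
    "'v set \<Rightarrow> 'v set set \<Rightarrow> 'a pair_pre_digraph \<Rightarrow> bool" where
  "kneser_representation V E G \<longleftrightarrow>
     hypergraph V E \<and> digraph_iso (with_proj (kneser_graph E)) (with_proj G)"

definition two_colorable :: "'v set \<Rightarrow> 'v set set \<Rightarrow> bool" where
  "two_colorable V E \<longleftrightarrow>
     (\<exists>c :: 'v \<Rightarrow> bool. \<forall>e\<in>E. \<forall>b. \<not> e \<subseteq> {v \<in> V. c v = b})"

definition colorability_defect :: "'v set \<Rightarrow> 'v set set \<Rightarrow> nat" where
  "colorability_defect V E =
     Min {card U | U. U \<subseteq> V \<and> two_colorable (V - U) {e \<in> E. e \<inter> U = {}}}"

text \<open>The minimum is unspecified only when there is an empty hyperedge, which is impossible in
  a Kneser representation of a loop-free graph.\<close>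

lemma colorability_defect_candidates:
  assumes "hypergraph V E" "{} \<notin> E"
  shows "finite {card U | U. U \<subseteq> V \<and> two_colorable (V - U) {e \<in> E. e \<inter> U = {}}}"
    and "{card U | U. U \<subseteq> V \<and> two_colorable (V - U) {e \<in> E. e \<inter> U = {}}} \<noteq> {}"
proof -
  have "finite V" using assms(1) by (simp add: hypergraph_def)
  then show "finite {card U | U. U \<subseteq> V \<and> two_colorable (V - U) {e \<in> E. e \<inter> U = {}}}"
    by simp
  have "e \<inter> V \<noteq> {}" if "e \<in> E" for e
    using assms that unfolding hypergraph_def by (metis inf.absorb_iff1)
  then have "two_colorable (V - V) {e \<in> E. e \<inter> V = {}}"
    unfolding two_colorable_def by blast
  then show "{card U | U. U \<subseteq> V \<and> two_colorable (V - U) {e \<in> E. e \<inter> U = {}}} \<noteq> {}"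
    by blast
qed

lemma kneser_representation_no_empty_edge:
  fixes E :: "'v set set"
  assumes "pair_graph G" "kneser_representation V E G"
  shows "{} \<notin> E"
proof
  assume empty: "{} \<in> E"
  interpret pair_graph G by fact
  obtain f where iso: "pre_digraph.digraph_isomorphism (with_proj (kneser_graph E)) f"
    and G: "with_proj G = app_iso f (with_proj (kneser_graph E))"
    using assms(2) by (auto simp: kneser_representation_def digraph_iso_def)
  let ?a = "({}, {}) :: 'v set \<times> 'v set"
  have a: "?a \<in> parcs (kneser_graph E)"
    using empty by (simp add: kneser_graph_def)
  have "arcs (with_proj G) = iso_arcs f ` parcs (kneser_graph E)"
    "tail (with_proj G) = iso_tail f" "head (with_proj G) = iso_head f"
    unfolding G by (simp_all add: arcs_app_iso tail_app_iso head_app_iso)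
  then have *: "iso_arcs f ?a \<in> parcs G" "fst = iso_tail f" "snd = iso_head f"
    using a by auto
  have "iso_verts f (tail (with_proj (kneser_graph E)) ?a) = iso_tail f (iso_arcs f ?a)"
    "iso_verts f (head (with_proj (kneser_graph E)) ?a) = iso_head f (iso_arcs f ?a)"
    using iso a unfolding pre_digraph.digraph_isomorphism_def by auto
  then have "fst (iso_arcs f ?a) = snd (iso_arcs f ?a)"
    by (simp flip: *(2,3))
  then show False
    using *(1) pair_no_loops by blast
qed

definition delete_vertex :: "'a \<Rightarrow> 'a pair_pre_digraph \<Rightarrow> 'a pair_pre_digraph" where
  "delete_vertex v G =
     \<lparr>pverts = pverts G - {v}, parcs = {(x, y) \<in> parcs G. x \<noteq> v \<and> y \<noteq> v}\<rparr>"

definition delete_edge :: "'a \<Rightarrow> 'a \<Rightarrow> 'a pair_pre_digraph \<Rightarrow> 'a pair_pre_digraph" where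
  "delete_edge u v G = \<lparr>pverts = pverts G, parcs = parcs G - {(u, v), (v, u)}\<rparr>"

text \<open>The vertex resulting from the contraction of \<open>uv\<close> is called \<open>u\<close>. The loop that arises is
  dropped; parallel edges are identified because the arcs form a set.\<close>

definition contract_edge :: "'a \<Rightarrow> 'a \<Rightarrow> 'a pair_pre_digraph \<Rightarrow> 'a pair_pre_digraph" where
  "contract_edge u v G =
     (let f = id(v := u) in
      \<lparr>pverts = f ` pverts G, parcs = {(f x, f y) | x y. (x, y) \<in> parcs G \<and> f x \<noteq> f y}\<rparr>)"

inductive minor_step :: "'a pair_pre_digraph \<Rightarrow> 'a pair_pre_digraph \<Rightarrow> bool" where
  vertex_deletion: "v \<in> pverts G \<Longrightarrow> minor_step G (delete_vertex v G)"
| edge_deletion: "(u, v) \<in> parcs G \<Longrightarrow> minor_step G (delete_edge u v G)"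
| edge_contraction: "(u, v) \<in> parcs G \<Longrightarrow> minor_step G (contract_edge u v G)"

definition has_minor :: "'a pair_pre_digraph \<Rightarrow> 'b pair_pre_digraph \<Rightarrow> bool" where
  "has_minor G H \<longleftrightarrow> (\<exists>G'. minor_step\<^sup>*\<^sup>* G G' \<and> digraph_iso (with_proj G') (with_proj H))"

definition complete_graph :: "nat \<Rightarrow> nat pair_pre_digraph" where
  "complete_graph t =
     \<lparr>pverts = {..<t}, parcs = {(u, v). u \<in> {..<t} \<and> v \<in> {..<t} \<and> u \<noteq> v}\<rparr>"

lemma complete_digraph_complete_graph: "complete_digraph t (with_proj (complete_graph t))"
  by (simp add: complete_digraph_pair_def complete_graph_def)

end

theory Submission
  imports Defs
begin

text \<open>Let \<open>U\<close> attain the defect and fix a 2-coloring of \<open>V - U\<close>. By minimality, every \<open>u \<in> U\<close> lies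
  for each color \<open>b\<close> in a hyperedge that consists of \<open>u\<close> and vertices of color \<open>b\<close>. Call these
  hyperedges \<open>x u\<close> and \<open>y u\<close>. Then \<open>x u\<close> and \<open>y w\<close> are disjoint for \<open>u \<noteq> w\<close>, so the Kneser graph
  contains a complete bipartite graph minus a perfect matching, where \<open>x u\<close> and \<open>y u\<close> are identified
  if \<open>{u}\<close> is a hyperedge. Let \<open>T = {u. x u \<noteq> y u}\<close>. If \<open>T\<close> has at least three elements, take a permutation
  \<open>\<sigma>\<close> of \<open>T\<close> without fixed points and 2-cycles: contracting the edges between \<open>x u\<close> and \<open>y (\<sigma> u)\<close>
  yields a complete graph. Otherwise a complete subgraph can be chosen directly.\<close>

section \<open>Clique minors with branch sets of at most two vertices\<close>

lemma pair_graph_iff: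
  "pair_graph G \<longleftrightarrow> finite (pverts G) \<and> parcs G \<subseteq> pverts G \<times> pverts G \<and> sym (parcs G) \<and> irrefl (parcs G)"
  (is "_ \<longleftrightarrow> ?R")
proof
  assume "pair_graph G"
  then interpret pair_graph G .
  show ?R
    using pair_finite_verts pair_sym_arcs
    by (auto simp: irrefl_def symmetric_def dest: in_arcsD1 in_arcsD2 pair_no_loops)
next
  assume R: ?R
  then have "finite (parcs G)" by (meson finite_SigmaI finite_subset)
  with R show "pair_graph G"
    by unfold_locales (auto simp: irrefl_def symmetric_def)
qed

lemma pair_graph_delete_vertex: "pair_graph G \<Longrightarrow> pair_graph (delete_vertex v G)"
  by (auto simp: pair_graph_iff delete_vertex_def sym_def irrefl_def)

lemma pair_graph_contract_edge:
  assumes "pair_graph G"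
  shows "pair_graph (contract_edge u v G)"
proof -
  let ?f = "id(v := u)"
  have *: "pverts (contract_edge u v G) = ?f ` pverts G"
    "parcs (contract_edge u v G) = {(?f x, ?f y) | x y. (x, y) \<in> parcs G \<and> ?f x \<noteq> ?f y}"
    by (simp_all add: contract_edge_def Let_def)
  have G: "finite (pverts G)" "\<And>x y. (x, y) \<in> parcs G \<Longrightarrow> x \<in> pverts G \<and> y \<in> pverts G"
    "\<And>x y. (x, y) \<in> parcs G \<Longrightarrow> (y, x) \<in> parcs G"
    using assms by (auto simp: pair_graph_iff sym_def)
  show ?thesis
    unfolding pair_graph_iff *
  proof (intro conjI)
    show "finite (?f ` pverts G)" using G(1) by simp
    show "{(?f x, ?f y) | x y. (x, y) \<in> parcs G \<and> ?f x \<noteq> ?f y} \<subseteq> ?f ` pverts G \<times> ?f ` pverts G"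
      using G(2) by blast
    show "sym {(?f x, ?f y) | x y. (x, y) \<in> parcs G \<and> ?f x \<noteq> ?f y}"
      unfolding sym_def using G(3) by (fastforce simp del: fun_upd_apply)
    show "irrefl {(?f x, ?f y) | x y. (x, y) \<in> parcs G \<and> ?f x \<noteq> ?f y}"
      unfolding irrefl_def by blast
  qed
qed

lemma digraph_iso_complete_graph:
  assumes "pair_graph G" and "parcs G = {(u, v). u \<in> pverts G \<and> v \<in> pverts G \<and> u \<noteq> v}"
  shows "digraph_iso (with_proj G) (with_proj (complete_graph (card (pverts G))))"
proof -
  interpret pair_graph G by fact
  obtain h where h: "bij_betw h (pverts G) {..<card (pverts G)}"
    using ex_bij_betw_finite_nat[OF pair_finite_verts] by (auto simp: atLeast0LessThan)
  let ?f = "\<lparr>iso_verts = h, iso_arcs = map_prod h h, iso_head = snd, iso_tail = fst\<rparr>"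
  have inj: "inj_on h (pverts G)" and im: "h ` pverts G = {..<card (pverts G)}"
    using h by (auto simp: bij_betw_def)
  have "inj_on (map_prod h h) (parcs G)"
    by (rule inj_on_subset[OF map_prod_inj_on[OF inj inj]]) (auto simp: assms(2))
  then have iso: "digraph_isomorphism ?f"
    using inj wf_digraph by (auto simp: digraph_isomorphism_def)
  have "map_prod h h ` parcs G = {(u, v). u \<in> h ` pverts G \<and> v \<in> h ` pverts G \<and> u \<noteq> v}"
    using inj by (force simp: assms(2) inj_on_eq_iff)
  then have "with_proj (complete_graph (card (pverts G))) = app_iso ?f (with_proj G)"
    by (simp add: app_iso_def complete_graph_def im with_proj_def)
  with iso show ?thesis unfolding digraph_iso_def by blast
qed

lemma has_minor_step: "minor_step G G' \<Longrightarrow> has_minor G' H \<Longrightarrow> has_minor G H"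
  unfolding has_minor_def by (meson converse_rtranclp_into_rtranclp)

text \<open>The branch set of \<open>i\<close> is \<open>{a i, b i}\<close>, a single vertex if \<open>a i = b i\<close>.\<close>

definition clique_model :: "'a pair_pre_digraph \<Rightarrow> 'i set \<Rightarrow> ('i \<Rightarrow> 'a) \<Rightarrow> ('i \<Rightarrow> 'a) \<Rightarrow> bool" where
  "clique_model G I a b \<longleftrightarrow>
     (\<forall>i\<in>I. a i \<in> pverts G \<and> b i \<in> pverts G \<and> (a i = b i \<or> (a i, b i) \<in> parcs G)) \<and>
     (\<forall>i\<in>I. \<forall>j\<in>I. i \<noteq> j \<longrightarrow> {a i, b i} \<inter> {a j, b j} = {} \<and>
        (\<exists>p\<in>{a i, b i}. \<exists>q\<in>{a j, b j}. (p, q) \<in> parcs G))"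

text \<open>Induction on the number of vertices: contract a two-vertex branch set, or else delete a
  vertex outside all branch sets. If neither is possible, the branch sets are singletons that cover
  the graph, so the graph itself is complete.\<close>

lemma has_minor_complete_graph:
  assumes "pair_graph G" "clique_model G I a b"
  shows "has_minor G (complete_graph (card I))"
  using assms
proof (induction "card (pverts G)" arbitrary: G a b rule: less_induct)
  case less
  interpret pair_graph G by fact
  note model = less.prems(2)[unfolded clique_model_def]
  consider (contract) i where "i \<in> I" "a i \<noteq> b i"
    | (delete) v where "v \<in> pverts G" "v \<notin> a ` I" "\<forall>i\<in>I. a i = b i"
    | (spanning) "pverts G \<subseteq> a ` I" "\<forall>i\<in>I. a i = b i"
    by blast
  then show ?case
  proof cases
    case contract
    let ?u = "a i" and ?v = "b i"
    \<comment> \<open>The contraction map. Since branch sets are disjoint, it moves no branch vertex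
      other than \<open>b i\<close>, so composing with \<open>f\<close> collapses branch set
      \<open>i\<close> and fixes the others.\<close>
    define f where "f = id(?v := ?u)"
    have arc: "(?u, ?v) \<in> parcs G" using model contract by blast
    have mem: "?u \<in> pverts G" "?v \<in> pverts G" using model contract by auto
    have pv: "pverts (contract_edge ?u ?v G) = pverts G - {?v}"
      using mem contract by (auto simp: contract_edge_def Let_def image_iff)
    have fverts: "f p \<in> pverts (contract_edge ?u ?v G)" if "p \<in> pverts G" for p
      using that by (simp add: contract_edge_def Let_def f_def)
    have fi: "f (a i) = ?u" "f (b i) = ?u" using contract by (auto simp: f_def)
    have fj: "f (a j) = a j" "f (b j) = b j" if "j \<in> I" "j \<noteq> i" for j
      using model that contract(1) by (auto simp: f_def)
    have keep: "(f p, f q) \<in> parcs (contract_edge ?u ?v G)"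
      if "(p, q) \<in> parcs G" "f p \<noteq> f q" for p q
      using that by (auto simp: contract_edge_def Let_def simp flip: f_def)
    have "clique_model (contract_edge ?u ?v G) I (f \<circ> a) (f \<circ> b)"
      unfolding clique_model_def
    proof (intro conjI ballI impI)
      fix j assume j: "j \<in> I"
      then show "(f \<circ> a) j \<in> pverts (contract_edge ?u ?v G)"
        and "(f \<circ> b) j \<in> pverts (contract_edge ?u ?v G)"
        using model fverts by auto
      have "(a j, b j) \<in> parcs G \<or> a j = b j" using model j by blast
      then show "(f \<circ> a) j = (f \<circ> b) j \<or>
          ((f \<circ> a) j, (f \<circ> b) j) \<in> parcs (contract_edge ?u ?v G)"
        using keep[of "a j" "b j"] by auto
    next
      fix j k assume jk: "j \<in> I" "k \<in> I" "j \<noteq> k"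
      then have disj: "{a j, b j} \<inter> {a k, b k} = {}" using model by blast
      \<comment> \<open>Branch sets only shrink, hence stay disjoint. This also shows that an arc
        between two of them does not become a loop, which the contraction would drop.\<close>
      have sub: "{f (a l), f (b l)} \<subseteq> {a l, b l}" if "l \<in> I" for l
        using fi fj that by (cases "l = i") auto
      show d: "{(f \<circ> a) j, (f \<circ> b) j} \<inter> {(f \<circ> a) k, (f \<circ> b) k} = {}"
        using sub[OF jk(1)] sub[OF jk(2)] disj by auto
      obtain p q where pq: "p \<in> {a j, b j}" "q \<in> {a k, b k}" "(p, q) \<in> parcs G"
        using model jk by meson
      have p: "f p \<in> {(f \<circ> a) j, (f \<circ> b) j}" and q: "f q \<in> {(f \<circ> a) k, (f \<circ> b) k}"
        using pq by auto
      then have "f p \<noteq> f q" using d by (metis disjoint_iff)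
      with p q keep pq(3)
      show "\<exists>p\<in>{(f \<circ> a) j, (f \<circ> b) j}. \<exists>q\<in>{(f \<circ> a) k, (f \<circ> b) k}.
          (p, q) \<in> parcs (contract_edge ?u ?v G)"
        by blast
    qed
    moreover have "card (pverts (contract_edge ?u ?v G)) < card (pverts G)"
      unfolding pv using mem pair_finite_verts by (intro card_Diff1_less)
    ultimately show ?thesis
      using less.hyps pair_graph_contract_edge[OF less.prems(1)] edge_contraction[OF arc]
        has_minor_step by blast
  next
    case delete
    have "clique_model (delete_vertex v G) I a b"
      using delete model unfolding clique_model_def delete_vertex_def
      by simp (metis imageI)
    moreover have "card (pverts (delete_vertex v G)) < card (pverts G)"
      using card_Diff1_less[OF pair_finite_verts delete(1)] by (simp add: delete_vertex_def)
    ultimately show ?thesis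
      using less.hyps pair_graph_delete_vertex[OF less.prems(1)] vertex_deletion[OF delete(1)]
        has_minor_step by blast
  next
    case spanning
    have verts: "pverts G = a ` I" using spanning model by auto
    have inj: "inj_on a I" using model by (auto simp: inj_on_def)
    have "parcs G = {(u, v). u \<in> pverts G \<and> v \<in> pverts G \<and> u \<noteq> v}"
    proof (intro equalityI subsetI)
      fix e assume "e \<in> {(u, v). u \<in> pverts G \<and> v \<in> pverts G \<and> u \<noteq> v}"
      then obtain i j where "e = (a i, a j)" "i \<in> I" "j \<in> I" "i \<noteq> j" unfolding verts by auto
      then show "e \<in> parcs G" using model spanning(2) by (metis insertE singletonD)
    qed (auto dest: in_arcsD1 in_arcsD2 pair_no_loops)
    from digraph_iso_complete_graph[OF less.prems(1) this]
    show ?thesis unfolding has_minor_def by (metis verts card_image inj rtranclp.rtrancl_refl)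
  qed
qed

section \<open>Complete bipartite graphs minus a perfect matching\<close>

text \<open>Number the elements of \<open>T\<close> and shift cyclically; a single cycle of length
  at least 3 has no fixed points and no 2-cycles.\<close>

lemma ex_permutation_no_short_cycles:
  assumes "finite T" "card T \<ge> 3"
  obtains \<sigma> where "bij_betw \<sigma> T T" "\<And>x. x \<in> T \<Longrightarrow> \<sigma> x \<noteq> x" "\<And>x. x \<in> T \<Longrightarrow> \<sigma> (\<sigma> x) \<noteq> x"
proof -
  let ?n = "card T"
  obtain h where h: "bij_betw h T {..<?n}"
    using ex_bij_betw_finite_nat[OF assms(1)] by (auto simp: atLeast0LessThan)
  define s where "s k = (if Suc k = ?n then 0 else Suc k)" for k
  have s: "bij_betw s {..<?n} {..<?n}"
  proof -
    have "inj_on s {..<?n}" by (auto simp: inj_on_def s_def split: if_splits)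
    moreover have "s ` {..<?n} \<subseteq> {..<?n}" by (auto simp: s_def)
    ultimately show ?thesis by (simp add: bij_betw_def endo_inj_surj)
  qed
  define \<sigma> where "\<sigma> = inv_into T h \<circ> s \<circ> h"
  have "bij_betw \<sigma> T T"
    unfolding \<sigma>_def using bij_betw_trans[OF bij_betw_trans[OF h s] bij_betw_inv_into[OF h]]
    by (simp add: comp_assoc)
  moreover have h\<sigma>: "h (\<sigma> x) = s (h x)" if "x \<in> T" for x
    using that bij_betwE[OF s] bij_betwE[OF h] bij_betw_inv_into_right[OF h] by (simp add: \<sigma>_def)
  moreover have "\<sigma> x \<in> T" if "x \<in> T" for x using calculation(1) that by (auto simp: bij_betw_def)
  moreover have "s k \<noteq> k" "s (s k) \<noteq> k" for k
    using assms(2) by (auto simp: s_def)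
  ultimately show thesis using that by metis
qed

lemma has_minor_complete_graph_bipartite:
  assumes G: "pair_graph G" and W: "finite W"
    and verts: "\<And>u. u \<in> W \<Longrightarrow> x u \<in> pverts G \<and> y u \<in> pverts G"
    and inj: "inj_on x W" "inj_on y W"
    and arcs: "\<And>u w. u \<in> W \<Longrightarrow> w \<in> W \<Longrightarrow> u \<noteq> w \<Longrightarrow> (x u, y w) \<in> parcs G"
  shows "has_minor G (complete_graph (card W))"
proof -
  interpret pair_graph G by fact
  define T where "T = {u \<in> W. x u \<noteq> y u}"
  then have "finite T" using W by simp
  have sym: "(p, q) \<in> parcs G \<Longrightarrow> (q, p) \<in> parcs G" for p q
    using G by (auto simp: pair_graph_iff sym_def)
  have xy: "x u \<noteq> y w" if "u \<in> W" "w \<in> W" "u \<noteq> w" for u w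
    using pair_no_loops[OF arcs[OF that]] by simp
  have xx: "x u = x w \<longleftrightarrow> u = w" and yy: "y u = y w \<longleftrightarrow> u = w" if "u \<in> W" "w \<in> W" for u w
    using that inj by (auto simp: inj_on_eq_iff)
  show ?thesis
  proof (cases "card T \<ge> 3")
    case True
    obtain \<sigma> where bij: "bij_betw \<sigma> T T"
      and \<sigma>: "\<And>u. u \<in> T \<Longrightarrow> \<sigma> u \<noteq> u" "\<And>u. u \<in> T \<Longrightarrow> \<sigma> (\<sigma> u) \<noteq> u"
      using ex_permutation_no_short_cycles[OF \<open>finite T\<close> True] by metis
    have \<sigma>T: "\<sigma> u \<in> T" if "u \<in> T" for u using bij that by (auto simp: bij_betw_def)
    have \<sigma>inj: "\<sigma> u = \<sigma> w \<longleftrightarrow> u = w" if "u \<in> T" "w \<in> T" for u w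
      using bij that by (auto simp: bij_betw_def inj_on_eq_iff)
    have TW: "u \<in> W" if "u \<in> T" for u using that by (simp add: T_def)
    \<comment> \<open>Extends \<open>\<sigma>\<close> by the identity. For \<open>u\<close> in
      \<open>W\<close> outside \<open>T\<close> the branch set is then the single vertex
      \<open>x u = y u\<close>.\<close>
    define r where "r u = (if u \<in> T then \<sigma> u else u)" for u
    have rW: "r u \<in> W" if "u \<in> W" for u using that \<sigma>T[of u] TW[of "\<sigma> u"] by (simp add: r_def)
    have r_neq: "r u \<noteq> r w" if "u \<noteq> w" for u w
      using that \<sigma>T[of u] \<sigma>T[of w] \<sigma>inj[of u w] by (auto simp: r_def)
    have r_eqD: "u \<in> T \<and> w \<in> T" if "r w = u" "u \<noteq> w" for u w
      using that \<sigma>T[of w] by (auto simp: r_def split: if_splits)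
    have "clique_model G W x (y \<circ> r)"
      unfolding clique_model_def
    proof (intro conjI ballI impI)
      fix u assume u: "u \<in> W"
      show "x u \<in> pverts G" "(y \<circ> r) u \<in> pverts G" using verts rW u by auto
      show "x u = (y \<circ> r) u \<or> (x u, (y \<circ> r) u) \<in> parcs G"
      proof (cases "u \<in> T")
        case True
        then have "r u \<noteq> u" using \<sigma>(1) by (simp add: r_def)
        then show ?thesis using arcs[of u "r u"] u rW[of u] by simp
      next
        case False
        then show ?thesis using u by (simp add: r_def T_def)
      qed
    next
      fix u w assume uw: "u \<in> W" "w \<in> W" "u \<noteq> w"
      \<comment> \<open>If \<open>r w\<close> differs from \<open>u\<close>, this is
        \<open>xy\<close>. Otherwise \<open>u\<close> lies in \<open>T\<close>, where
        \<open>x u\<close> and \<open>y u\<close> differ by definition.\<close>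
      have ne: "x u \<noteq> y (r w)" if "u \<in> W" "w \<in> W" "u \<noteq> w" for u w
        using that xy[of u "r w"] rW[of w] r_eqD[of w u] by (cases "r w = u") (auto simp: T_def)
      show "{x u, (y \<circ> r) u} \<inter> {x w, (y \<circ> r) w} = {}"
        using uw ne[of u w] ne[of w u] xx[of u w] yy[of "r u" "r w"] rW[of u] rW[of w] r_neq[of u w]
        by simp
      show "\<exists>p\<in>{x u, (y \<circ> r) u}. \<exists>q\<in>{x w, (y \<circ> r) w}. (p, q) \<in> parcs G"
      \<comment> \<open>The arc from \<open>x u\<close> to \<open>y (r w)\<close> joins the branch
        sets unless \<open>r w = u\<close>. In that case \<open>r u\<close> is not \<open>w\<close>,
        because \<open>\<sigma>\<close> has no 2-cycle, and \<open>y (r u)\<close> is adjacent to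
        \<open>x w\<close>.\<close>
      proof (cases "r w = u")
        case True
        then have "r u \<noteq> w" using r_eqD[OF True uw(3)] \<sigma>(2)[of w] by (auto simp: r_def)
        then have "(y (r u), x w) \<in> parcs G" using arcs[of w "r u"] uw rW sym by metis
        then show ?thesis by auto
      next
        case False
        then show ?thesis using arcs[of u "r w"] uw rW[of w] by auto
      qed
    qed
    then show ?thesis by (rule has_minor_complete_graph[OF G])
  next
    case False
    \<comment> \<open>As \<open>T\<close> has at most two elements, removing a suitable
      \<open>p\<close> leaves at most one.\<close>
    have "\<exists>p. card (T - {p}) \<le> Suc 0"
    proof (cases "T = {}")
      case False
      then obtain p where "p \<in> T" by blast
      then show ?thesis using \<open>\<not> card T \<ge> 3\<close> \<open>finite T\<close> by (intro exI[of _ p]) simp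
    qed simp
    then obtain p where p: "card (T - {p}) \<le> Suc 0" ..
    have unique: "u = w" if "u \<in> T" "w \<in> T" "u \<noteq> p" "w \<noteq> p" for u w
      using p that \<open>finite T\<close> by (auto simp: card_le_Suc0_iff_eq)
    \<comment> \<open>Choosing \<open>y\<close> only at \<open>p\<close> gives a clique: of two
      distinct indices other than \<open>p\<close>, at least one lies outside \<open>T\<close>, so
      its vertex also serves as its \<open>y\<close>-vertex.\<close>
    let ?a = "\<lambda>u. if u = p then y u else x u"
    have adj: "(?a u, ?a w) \<in> parcs G" if uw: "u \<in> W" "w \<in> W" "u \<noteq> w" for u w
    proof -
      consider "u = p" | "w = p" | "u \<noteq> p" "w \<noteq> p" "x u = y u" | "u \<noteq> p" "w \<noteq> p" "x w = y w"
        using unique[of u w] uw by (auto simp: T_def)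
      then show ?thesis
        using arcs[of u w] sym[OF arcs[of w u]] uw by cases auto
    qed
    then have "clique_model G W ?a ?a"
      using verts pair_no_loops unfolding clique_model_def by fastforce
    then show ?thesis by (rule has_minor_complete_graph[OF G])
  qed
qed

section \<open>Hyperedges from the colorability defect\<close>

text \<open>In a pair digraph an arc is determined by its tail and head, so the arc map of the
  isomorphism is forced by its vertex map and adjacency can be read off from the latter.\<close>

lemma kneser_representation_vertex_map:
  assumes "kneser_representation V E G"
  obtains \<phi> where "inj_on \<phi> E" "\<phi> ` E = pverts G"
    "\<And>e e'. e \<in> E \<Longrightarrow> e' \<in> E \<Longrightarrow> e \<inter> e' = {} \<Longrightarrow> (\<phi> e, \<phi> e') \<in> parcs G"
proof -
  obtain f where iso: "pre_digraph.digraph_isomorphism (with_proj (kneser_graph E)) f"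
    and G: "with_proj G = app_iso f (with_proj (kneser_graph E))"
    using assms by (auto simp: kneser_representation_def digraph_iso_def)
  have *: "pverts G = iso_verts f ` E" "parcs G = iso_arcs f ` parcs (kneser_graph E)"
    "iso_tail f = fst" "iso_head f = snd"
    using arg_cong[OF G, of verts] arg_cong[OF G, of arcs] arg_cong[OF G, of tail]
      arg_cong[OF G, of head]
    by (simp_all add: kneser_graph_def)
  have "(iso_verts f e, iso_verts f e') \<in> parcs G" if "e \<in> E" "e' \<in> E" "e \<inter> e' = {}" for e e'
  proof -
    have a: "(e, e') \<in> parcs (kneser_graph E)" using that by (simp add: kneser_graph_def)
    then have "iso_arcs f (e, e') = (iso_verts f e, iso_verts f e')"
      using iso unfolding pre_digraph.digraph_isomorphism_def *(3,4) by (auto simp: prod_eq_iff)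
    then show ?thesis using a *(2) by (metis imageI)
  qed
  moreover have "inj_on (iso_verts f) E"
    using iso by (simp add: pre_digraph.digraph_isomorphism_def kneser_graph_def)
  ultimately show thesis using that *(1) by blast
qed

text \<open>Returning \<open>u\<close> to the colored part with color \<open>b\<close> must create a
  monochromatic hyperedge, as \<open>U - {u}\<close> is too small to leave a 2-colorable hypergraph.
  One coloring \<open>c\<close> serves all \<open>u\<close> and \<open>b\<close>; this makes
  hyperedges for different \<open>u\<close> and opposite colors disjoint.\<close>

lemma colorability_defect_witness:
  assumes "hypergraph V E" "{} \<notin> E"
  obtains U c where "U \<subseteq> V" "card U = colorability_defect V E"
    "\<And>u b. u \<in> U \<Longrightarrow> \<exists>e\<in>E. u \<in> e \<and> e \<subseteq> insert u {v \<in> V - U. c v = (b :: bool)}"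
proof -
  let ?S = "{card U | U. U \<subseteq> V \<and> two_colorable (V - U) {e \<in> E. e \<inter> U = {}}}"
  note S = colorability_defect_candidates[OF assms]
  have "colorability_defect V E \<in> ?S" unfolding colorability_defect_def by (rule Min_in[OF S])
  then obtain U where U: "U \<subseteq> V" "card U = colorability_defect V E"
    and colorable: "two_colorable (V - U) {e \<in> E. e \<inter> U = {}}" by auto
  obtain c :: "_ \<Rightarrow> bool" where
    c: "\<forall>e\<in>{e \<in> E. e \<inter> U = {}}. \<forall>b. \<not> e \<subseteq> {v \<in> V - U. c v = b}"
    using iffD1[OF two_colorable_def colorable] ..
  have "\<exists>e\<in>E. u \<in> e \<and> e \<subseteq> insert u {v \<in> V - U. c v = b}" if u: "u \<in> U" for u b
  proof -
    have "finite U" using U(1) assms(1) by (metis finite_subset hypergraph_def)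
    then have "card (U - {u}) < colorability_defect V E"
      using u U(2) by (metis card_Diff1_less)
    then have "card (U - {u}) \<notin> ?S"
      unfolding colorability_defect_def using Min_le[OF S(1)] leD by blast
    then have "\<not> two_colorable (V - (U - {u})) {e \<in> E. e \<inter> (U - {u}) = {}}"
      using U(1) by blast
    then have "\<not> (\<forall>e\<in>{e \<in> E. e \<inter> (U - {u}) = {}}. \<forall>b'.
        \<not> e \<subseteq> {v \<in> V - (U - {u}). (c(u := b)) v = b'})"
      unfolding two_colorable_def by (rule contrapos_nn) (rule exI)
    then obtain e b' where e: "e \<in> E" "e \<inter> (U - {u}) = {}"
      "e \<subseteq> {v \<in> V - (U - {u}). (c(u := b)) v = b'}"
      by blast
    \<comment> \<open>A hyperedge avoiding \<open>u\<close> would miss all of \<open>U\<close> and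
      already be monochromatic under \<open>c\<close>.\<close>
    have "u \<in> e"
    proof (rule ccontr)
      assume u_notin: "u \<notin> e"
      then have "e \<inter> U = {}" using e(2) by blast
      moreover have "e \<subseteq> {v \<in> V - U. c v = b'}"
      proof
        fix v assume "v \<in> e"
        then show "v \<in> {v \<in> V - U. c v = b'}"
          using u_notin \<open>e \<inter> U = {}\<close> subsetD[OF e(3), of v] by (cases "v = u") auto
      qed
      ultimately show False using c e(1) by simp
    qed
    \<comment> \<open>The common color of \<open>e\<close> is that of its element \<open>u\<close>,
      which was recolored to \<open>b\<close>.\<close>
    moreover from this have "b' = b" using e(3) by auto
    moreover have "e \<subseteq> insert u {v \<in> V - U. c v = b'}"
    proof
      fix v assume "v \<in> e"
      then show "v \<in> insert u {v \<in> V - U. c v = b'}"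
        using subsetD[OF e(3), of v] by (cases "v = u") auto
    qed
    ultimately show ?thesis using e(1) by blast
  qed
  with U show thesis using that by blast
qed

theorem theorem2:
  fixes t :: nat
    and G :: "'a pair_pre_digraph"
    and V :: "'v set"
    and E :: "'v set set"
  assumes "t > 0"
    and "pair_graph G"
    and "kneser_representation V E G"
    and "colorability_defect V E \<ge> t"
  shows "has_minor G (complete_graph t)"
proof -
  have H: "hypergraph V E" using assms(3) by (simp add: kneser_representation_def)
  obtain U c where U: "U \<subseteq> V" "card U = colorability_defect V E"
    and ex: "\<And>u b. u \<in> U \<Longrightarrow> \<exists>e\<in>E. u \<in> e \<and> e \<subseteq> insert u {v \<in> V - U. c v = (b :: bool)}"
    using colorability_defect_witness[OF H kneser_representation_no_empty_edge[OF assms(2,3)]]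
    by metis
  then obtain g where g: "\<And>u b. u \<in> U \<Longrightarrow> g u b \<in> E" "\<And>u b. u \<in> U \<Longrightarrow> u \<in> g u b"
    "\<And>u b. u \<in> U \<Longrightarrow> g u b \<subseteq> insert u {v \<in> V - U. c v = b}"
    by metis
  have disj: "g u True \<inter> g w False = {}" if "u \<in> U" "w \<in> U" "u \<noteq> w" for u w
    using g(3)[of u True] g(3)[of w False] that by blast
  \<comment> \<open>The only element of \<open>U\<close> in \<open>g u b\<close> is
    \<open>u\<close>, so the hyperedge determines \<open>u\<close>.\<close>
  have ginj: "u = w" if "u \<in> U" "w \<in> U" "g u b = g w b" for u w b
    using g(2)[of u b] g(3)[of w b] that by auto
  obtain \<phi> where \<phi>: "inj_on \<phi> E" "\<phi> ` E = pverts G"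
    "\<And>e e'. e \<in> E \<Longrightarrow> e' \<in> E \<Longrightarrow> e \<inter> e' = {} \<Longrightarrow> (\<phi> e, \<phi> e') \<in> parcs G"
    using kneser_representation_vertex_map[OF assms(3)] by metis
  have \<phi>ginj: "inj_on (\<lambda>u. \<phi> (g u b)) U" for b
    by (intro inj_onI) (metis ginj g(1) \<phi>(1) inj_onD)
  \<comment> \<open>The defect may exceed \<open>t\<close>; exactly \<open>t\<close> elements of
    \<open>U\<close> are kept as indices of the branch sets.\<close>
  obtain W where W: "W \<subseteq> U" "card W = t" "finite W"
    using obtain_subset_with_card_n assms(4) U(2) by metis
  have "has_minor G (complete_graph (card W))"
  proof (rule has_minor_complete_graph_bipartite[OF assms(2) W(3),
        where x = "\<lambda>u. \<phi> (g u True)" and y = "\<lambda>u. \<phi> (g u False)"])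
    show "\<phi> (g u True) \<in> pverts G \<and> \<phi> (g u False) \<in> pverts G" if "u \<in> W" for u
      using that W(1) g(1) \<phi>(2) by blast
    show "(\<phi> (g u True), \<phi> (g w False)) \<in> parcs G" if "u \<in> W" "w \<in> W" "u \<noteq> w" for u w
      by (intro \<phi>(3) g(1) disj that(3) subsetD[OF W(1)] that(1,2))
  qed (use inj_on_subset[OF \<phi>ginj W(1)] in auto)
  then show ?thesis using W(2) by simp
qed

end
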